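(* Let $(\mathbb{Z}\times_K\mathbb{Z})^o$ denote the connected component of the Kronecker product $\mathbb{Z}\times_K\mathbb{Z}$ containing $o=(0,0)$. Then there is a graph isomorphism \[ (\mathbb{Z}\times_K\mathbb{Z})^o\cong\mathbb{Z}\times_C\mathbb{Z} \] which preserves the origin, i.e. maps $(0,0)$ to $(0,0)$.
   Context: Graphs are undirected, without loops or multiple edges. $\mathbb{Z}$ is regarded as the one-dimensional integer lattice graph: $x\sim x'$ if and only if $x'=x\pm1$. The Kronecker product $\mathbb{Z}\times_K\mathbb{Z}$ is the graph on $\mathbb{Z}^2$ in which $(u,v)\sim(u',v')$ if and only if $u'=u\pm1$ and $v'=v\pm1$ (signs independent). The Cartesian product $\mathbb{Z}\times_C\mathbb{Z}$ is the usual 2-dimensional integer lattice: the graph on $\mathbb{Z}^2$ in which $(x,y)\sim(x',y')$ if and only if either $x'=x\pm1$ and $y'=y$, or $x'=x$ and $y'=y\pm1$. *)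

theory Defs
  imports "Graph_Theory.Graph_Theory"
begin

text \<open>
  An undirected graph is a symmetric loop-free digraph whose arcs are pairs of vertices, so every
  undirected edge is represented by its two orientations and multiple edges cannot occur.
  The library locale \<open>graph\<close> also demands finiteness and is therefore not applicable here;
  \<open>pair_bidirected_digraph\<close> is the same notion without finiteness.
\<close>

definition int_line :: "int pair_pre_digraph" where
  "int_line = \<lparr> pverts = UNIV, parcs = {(x, x'). x' = x + 1 \<or> x' = x - 1} \<rparr>"

definition kronecker_product ::
    "'a pair_pre_digraph \<Rightarrow> 'b pair_pre_digraph \<Rightarrow> ('a \<times> 'b) pair_pre_digraph" where
  "kronecker_product G H = \<lparr>
     pverts = pverts G \<times> pverts H,
     parcs = {((u, v), (u', v')). (u, u') \<in> parcs G \<and> (v, v') \<in> parcs H} \<rparr>"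

definition cartesian_product ::
    "'a pair_pre_digraph \<Rightarrow> 'b pair_pre_digraph \<Rightarrow> ('a \<times> 'b) pair_pre_digraph" where
  "cartesian_product G H = \<lparr>
     pverts = pverts G \<times> pverts H,
     parcs = {((x, y), (x', y')).
       (x, x') \<in> parcs G \<and> y' = y \<and> y \<in> pverts H \<or>
       x' = x \<and> x \<in> pverts G \<and> (y, y') \<in> parcs H} \<rparr>"

text \<open>
  In a symmetric digraph the strongly connected component of a vertex is its connected component.
\<close>

definition component_of :: "('a, 'b) pre_digraph \<Rightarrow> 'a \<Rightarrow> ('a, 'b) pre_digraph" where
  "component_of G v = G \<restriction> pre_digraph.scc_of G v"

lemma parcs_kronecker_int_line:
  "((u, v), (u', v')) \<in> parcs (kronecker_product int_line int_line) \<longleftrightarrow>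
     (u' = u + 1 \<or> u' = u - 1) \<and> (v' = v + 1 \<or> v' = v - 1)"
  by (simp add: kronecker_product_def int_line_def)

lemma parcs_cartesian_int_line:
  "((x, y), (x', y')) \<in> parcs (cartesian_product int_line int_line) \<longleftrightarrow>
     (x' = x + 1 \<or> x' = x - 1) \<and> y' = y \<or> x' = x \<and> (y' = y + 1 \<or> y' = y - 1)"
  by (simp add: cartesian_product_def int_line_def)

lemma pair_bidirected_int_line: "pair_bidirected_digraph int_line"
  by unfold_locales (auto simp: int_line_def symmetric_def sym_def)

lemma pair_bidirected_kronecker_product:
  assumes "pair_bidirected_digraph G" "pair_bidirected_digraph H"
  shows "pair_bidirected_digraph (kronecker_product G H)"
proof -
  interpret G: pair_bidirected_digraph G by fact
  interpret H: pair_bidirected_digraph H by fact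
  have "sym (parcs G)" "sym (parcs H)"
    using G.pair_sym_arcs H.pair_sym_arcs by (simp_all add: symmetric_def)
  then have "sym (parcs (kronecker_product G H))"
    by (auto simp: kronecker_product_def sym_def)
  moreover have "u \<in> pverts G \<and> u' \<in> pverts G \<and> u \<noteq> u'" if "(u, u') \<in> parcs G" for u u'
    using that G.arc_fst_in_verts G.arc_snd_in_verts G.pair_no_loops by fastforce
  moreover have "v \<in> pverts H \<and> v' \<in> pverts H \<and> v \<noteq> v'" if "(v, v') \<in> parcs H" for v v'
    using that H.arc_fst_in_verts H.arc_snd_in_verts H.pair_no_loops by fastforce
  ultimately show ?thesis
    by unfold_locales (auto simp: kronecker_product_def symmetric_def)
qed

lemma pair_bidirected_cartesian_product:
  assumes "pair_bidirected_digraph G" "pair_bidirected_digraph H"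
  shows "pair_bidirected_digraph (cartesian_product G H)"
proof -
  interpret G: pair_bidirected_digraph G by fact
  interpret H: pair_bidirected_digraph H by fact
  have "sym (parcs G)" "sym (parcs H)"
    using G.pair_sym_arcs H.pair_sym_arcs by (simp_all add: symmetric_def)
  then have "sym (parcs (cartesian_product G H))"
    by (auto simp: cartesian_product_def sym_def)
  moreover have "u \<in> pverts G \<and> u' \<in> pverts G \<and> u \<noteq> u'" if "(u, u') \<in> parcs G" for u u'
    using that G.arc_fst_in_verts G.arc_snd_in_verts G.pair_no_loops by fastforce
  moreover have "v \<in> pverts H \<and> v' \<in> pverts H \<and> v \<noteq> v'" if "(v, v') \<in> parcs H" for v v'
    using that H.arc_fst_in_verts H.arc_snd_in_verts H.pair_no_loops by fastforce
  ultimately show ?thesis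
    by unfold_locales (auto simp: cartesian_product_def symmetric_def)
qed

end

theory Submission
  imports Defs
begin

text \<open>
  A Kronecker step changes \<open>u + v\<close> and \<open>u - v\<close> by \<open>\<plusminus>2\<close> in one of them and by \<open>0\<close> in the other,
  according to whether the two signs agree. Hence the linear map
  \<open>(u, v) \<mapsto> ((u + v) / 2, (u - v) / 2)\<close>, a rotation by 45 degrees up to scaling and reflection,
  turns the diagonal steps into the axis-parallel steps of the Cartesian product
  (\<open>kronecker_arc_iff_cartesian_arc\<close>). It is integral exactly on the points with \<open>u + v\<close> even,
  which it maps bijectively onto \<open>\<int> \<times> \<int>\<close>, and it fixes the origin.

  What remains is that these points form the component of the origin
  (\<open>scc_of_kronecker_int_line\<close>). Each Kronecker step preserves the parity of \<open>u + v\<close>, so the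
  component contains no others; conversely, every even point is \<open>(x + y, x - y)\<close> for some integers
  \<open>x\<close> and \<open>y\<close>, and is reached by walking along the diagonal to \<open>(x, x)\<close> and then along the
  antidiagonal through that point.
\<close>

text \<open>Integer division is exact on the even points; the values elsewhere are meaningless.\<close>

definition rotate_even :: "int \<times> int \<Rightarrow> int \<times> int" where
  "rotate_even = (\<lambda>(u, v). ((u + v) div 2, (u - v) div 2))"

lemma rotate_even_inverse: "rotate_even (x + y, x - y) = (x, y)"
  by (simp add: rotate_even_def)

text \<open>Inverts the rotation: in the coordinates \<open>x\<close> and \<open>y\<close> no division occurs.\<close>

lemma even_pair_cases:
  fixes u v :: int
  assumes "even (u + v)"
  obtains x y where "u = x + y" "v = x - y"
proof -
  from assms have "even (u - v)" by simp
  then obtain y where "u - v = 2 * y" by (rule evenE)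
  moreover from assms obtain x where "u + v = 2 * x" by (rule evenE)
  ultimately show thesis by (intro that[of x y]) auto
qed

lemma bij_betw_rotate_even: "bij_betw rotate_even {(u, v). even (u + v)} UNIV"
proof (rule bij_betw_byWitness[where f' = "\<lambda>(x, y). (x + y, x - y)"])
  show "\<forall>w \<in> {(u, v). even (u + v)}. (case rotate_even w of (x, y) \<Rightarrow> (x + y, x - y)) = w"
  proof
    fix w :: "int \<times> int" assume "w \<in> {(u, v). even (u + v)}"
    then obtain u v where w: "w = (u, v)" and even: "even (u + v)" by blast
    from even obtain x y where "u = x + y" "v = x - y" by (rule even_pair_cases)
    then show "(case rotate_even w of (x, y) \<Rightarrow> (x + y, x - y)) = w"
      by (simp add: w rotate_even_inverse)
  qed
qed (auto simp: rotate_even_inverse)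

text \<open>The two signs of a Kronecker step agree iff the step moves \<open>x\<close>, and differ iff it moves \<open>y\<close>.\<close>

lemma kronecker_arc_iff_cartesian_arc:
  "((x + y, x - y), (x' + y', x' - y')) \<in> parcs (kronecker_product int_line int_line) \<longleftrightarrow>
   ((x, y), (x', y')) \<in> parcs (cartesian_product int_line int_line)"
  unfolding parcs_kronecker_int_line parcs_cartesian_int_line by smt

text \<open>
  By symmetry a bi-infinite walk can be traversed backwards, so a single hypothesis covers both
  directions.
\<close>

lemma (in sym_digraph) reachable_along_int_walk:
  fixes p :: "int \<Rightarrow> 'a"
  assumes step: "\<And>i. p i \<rightarrow>\<^bsub>G\<^esub> p (i + 1)"
  shows "p 0 \<rightarrow>\<^sup>* p n"
proof (induction n rule: int_induct[where k = 0])
  case base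
  show ?case using adj_in_verts(1)[OF step] by (rule reachable_refl)
next
  case (step1 i)
  then show ?case using step reachable_adj_trans by blast
next
  case (step2 i)
  have "p i \<rightarrow>\<^bsub>G\<^esub> p (i - 1)"
    using step[of "i - 1"] sym_arcs by (auto simp: symmetric_def dest: symD)
  with step2 show ?case using reachable_adj_trans by blast
qed

lemma scc_of_kronecker_int_line:
  "pre_digraph.scc_of (with_proj (kronecker_product int_line int_line)) (0, 0)
     = {(u, v). even (u + v)}" (is "pre_digraph.scc_of ?G _ = ?E")
proof -
  interpret pair_bidirected_digraph "kronecker_product int_line int_line"
    by (intro pair_bidirected_kronecker_product pair_bidirected_int_line)
  have parity: "w \<in> ?E" if "(0, 0) \<rightarrow>\<^sup>*\<^bsub>?G\<^esub> w" for w
    using that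
  proof (induction rule: reachable_induct)
    case base
    show ?case by simp
  next
    case (step w w')
    then show ?case
      by (cases w; cases w') (auto simp: parcs_kronecker_int_line)
  qed
  have reach: "(0, 0) \<rightarrow>\<^sup>*\<^bsub>?G\<^esub> (u, v)" if even: "even (u + v)" for u v
  proof -
    from even obtain x y where uv: "u = x + y" "v = x - y" by (rule even_pair_cases)
    have "(0, 0) \<rightarrow>\<^sup>*\<^bsub>?G\<^esub> (x, x)"
      using reachable_along_int_walk[of "\<lambda>i. (i, i)" x] by (simp add: parcs_kronecker_int_line)
    also have "(x, x) \<rightarrow>\<^sup>*\<^bsub>?G\<^esub> (x + y, x - y)"
      using reachable_along_int_walk[of "\<lambda>i. (x + i, x - i)" y]
      by (simp add: parcs_kronecker_int_line)
    finally show ?thesis by (simp add: uv)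
  qed
  show ?thesis
  proof (intro subset_antisym subsetI)
    fix w assume "w \<in> scc_of (0, 0)"
    then have "(0, 0) \<rightarrow>\<^sup>*\<^bsub>?G\<^esub> w" unfolding scc_of_def by (elim CollectE conjE)
    then show "w \<in> ?E" by (rule parity)
  next
    fix w assume "w \<in> ?E"
    then have "(0, 0) \<rightarrow>\<^sup>*\<^bsub>?G\<^esub> w" by (cases w) (simp add: reach del: even_add)
    then show "w \<in> scc_of (0, 0)" by (rule scc_ofI_reachable')
  qed
qed

lemma rotate_even_image_kronecker_arcs:
  "map_prod rotate_even rotate_even `
     {e \<in> parcs (kronecker_product int_line int_line).
        fst e \<in> {(u, v). even (u + v)} \<and> snd e \<in> {(u, v). even (u + v)}}
   = parcs (cartesian_product int_line int_line)" (is "?r ` ?A = ?C")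
proof (intro subset_antisym subsetI)
  fix e assume "e \<in> ?r ` ?A"
  then obtain u v u' v' where e: "e = (rotate_even (u, v), rotate_even (u', v'))"
    and arc: "((u, v), (u', v')) \<in> parcs (kronecker_product int_line int_line)"
    and even: "even (u + v)" "even (u' + v')"
    by (clarsimp simp del: even_add)
  from even(1) obtain x y where "u = x + y" "v = x - y" by (rule even_pair_cases)
  moreover from even(2) obtain x' y' where "u' = x' + y'" "v' = x' - y'"
    by (rule even_pair_cases)
  ultimately show "e \<in> ?C"
    using arc by (simp add: e rotate_even_inverse kronecker_arc_iff_cartesian_arc)
next
  fix e assume e: "e \<in> ?C"
  obtain x y x' y' where e_eq: "e = ((x, y), (x', y'))" by (metis surj_pair)
  have "((x + y, x - y), (x' + y', x' - y')) \<in> ?A"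
    using e by (simp add: e_eq kronecker_arc_iff_cartesian_arc)
  moreover have "e = ?r ((x + y, x - y), (x' + y', x' - y'))"
    by (simp add: e_eq rotate_even_inverse)
  ultimately show "e \<in> ?r ` ?A" by (rule rev_image_eqI)
qed

theorem theorem4p1:
  fixes K :: "(int \<times> int, (int \<times> int) \<times> (int \<times> int)) pre_digraph"
    and L :: "(int \<times> int, (int \<times> int) \<times> (int \<times> int)) pre_digraph"
  defines "K \<equiv> component_of (with_proj (kronecker_product int_line int_line)) (0, 0)"
    and "L \<equiv> with_proj (cartesian_product int_line int_line)"
  shows "\<exists>f. pre_digraph.digraph_isomorphism K f \<and> app_iso f K = L \<and>
             iso_verts f (0, 0) = (0, 0)"
proof -
  let ?G = "kronecker_product int_line int_line"
  let ?E = "{(u, v). even (u + v)} :: (int \<times> int) set"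
  let ?f = "\<lparr>iso_verts = rotate_even, iso_arcs = map_prod rotate_even rotate_even,
    iso_head = snd, iso_tail = fst\<rparr>"
  interpret pair_bidirected_digraph ?G
    by (intro pair_bidirected_kronecker_product pair_bidirected_int_line)
  have K: "K = with_proj ?G \<restriction> ?E"
    by (simp add: K_def component_of_def scc_of_kronecker_int_line)
  have arcs_K: "arcs K = {e \<in> parcs ?G. fst e \<in> ?E \<and> snd e \<in> ?E}"
    by (simp add: K)
  have inj: "inj_on rotate_even ?E" and surj: "rotate_even ` ?E = UNIV"
    using bij_betw_rotate_even by (auto simp: bij_betw_def)
  have "wf_digraph K"
    unfolding K by (intro wellformed_induce_subgraph)
  moreover have "inj_on (map_prod rotate_even rotate_even) (arcs K)"
    by (rule inj_on_subset[OF map_prod_inj_on[OF inj inj]]) (auto simp: arcs_K)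
  ultimately have "pre_digraph.digraph_isomorphism K ?f"
    using inj by (simp add: pre_digraph.digraph_isomorphism_def K)
  moreover have "app_iso ?f K = L"
  proof (rule pre_digraph.equality)
    show "verts (app_iso ?f K) = verts L"
      using surj by (simp add: K L_def cartesian_product_def int_line_def)
    show "arcs (app_iso ?f K) = arcs L"
      using rotate_even_image_kronecker_arcs by (simp add: arcs_K L_def)
  qed (simp_all add: L_def)
  moreover have "iso_verts ?f (0, 0) = (0, 0)"
    by (simp add: rotate_even_def)
  ultimately show ?thesis by blast
qed

end
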